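(* Let $q\ge 1$ be an integer, let $(X,\Delta)$ be an $\mathbb{R}^q$-valued metric space, let $\preceq$ be a quasi-order (reflexive and transitive relation) on $X$, and let $T:X\to X$ be a map such that $X(T,\preceq):=\{x\in X: x\preceq Tx\}$ is nonempty and $T$ is increasing ($x\preceq y$ implies $Tx\preceq Ty$). Assume that $\Delta$ is $(\preceq)$-complete and that there exists a normal $q\times q$ matrix $A$ with nonnegative real entries such that $$\Delta(Tx,Ty)\le A\,\Delta(x,y)\quad\text{for all } x,y\in X \text{ with } x\preceq y.$$ In addition, suppose that either $T$ is $(\Delta,\preceq)$-continuous or $(\preceq)$ is $\Delta$-self-closed. Then $T$ is a Picard operator (modulo $(\Delta,\preceq)$).
   Context: On $\mathbb{R}^q$, $\le$ is the componentwise order, and $z>0$ means that all components of $z$ are strictly positive. An $\mathbb{R}^q$-valued metric on $X$ is a function $\Delta:X\times X\to\mathbb{R}_+^q$ with $\Delta(x,y)=0$ iff $x=y$, $\Delta(x,z)\le\Delta(x,y)+\Delta(y,z)$, and $\Delta(x,y)=\Delta(y,x)$ for all $x,y,z\in X$; the pair $(X,\Delta)$ is then an $\mathbb{R}^q$-valued metric space. A sequence $(x_n)$ $\Delta$-converges to $x$ (with $x$ its $\Delta$-limit) if $\Delta(x_n,x)\to 0$ in $\mathbb{R}^q$; it is $\Delta$-Cauchy if $\Delta(x_i,x_j)\to 0$ as $i,j\to\infty$; it is ascending if $x_n\preceq x_m$ whenever $n\le m$. $\Delta$ is $(\preceq)$-complete if each ascending $\Delta$-Cauchy sequence is $\Delta$-convergent.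 $(\preceq)$ is $\Delta$-self-closed if the $\Delta$-limit $x$ of each ($\Delta$-convergent) ascending sequence $(x_n)$ satisfies $x_n\preceq x$ for all $n$. $T$ is $(\Delta,\preceq)$-continuous if, whenever $(x_n)$ is ascending and $\Delta$-converges to $x$, $(Tx_n)$ $\Delta$-converges to $Tx$. A $q\times q$ matrix $A$ with nonnegative entries is normal if $\nu(A)<1$, where $\nu(A)=\inf\{\lambda\ge0: Az\le\lambda z \text{ for some } z>0\}$; equivalently, there is $z>0$ such that every component of $Az$ is strictly less than the corresponding component of $z$. $T$ is a Picard operator (modulo $(\Delta,\preceq)$) if for each $x\in X(T,\preceq)$ the sequence $(T^nx)_{n\ge 0}$ is $\Delta$-convergent and its limit $z$ satisfies $z=Tz$. *)

theory Defs
  imports "HOL-Analysis.Analysis"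
begin

text \<open>
  Throughout, the space is a carrier set \<open>X\<close>, and \<open>\<real>\<^sup>q\<close> is \<^typ>\<open>real ^ 'q\<close> with its
  componentwise order \<open>\<le>\<close>. The strict order \<open><\<close> of that type is not componentwise
  (it only means \<open>\<le>\<close> and \<open>\<noteq>\<close>), so strict positivity of all components is spelled out.
\<close>

definition vmetric_on :: "'a set \<Rightarrow> ('a \<Rightarrow> 'a \<Rightarrow> real ^ 'q) \<Rightarrow> bool" where
  "vmetric_on X \<Delta> \<longleftrightarrow>
     (\<forall>x\<in>X. \<forall>y\<in>X. 0 \<le> \<Delta> x y) \<and>
     (\<forall>x\<in>X. \<forall>y\<in>X. \<Delta> x y = 0 \<longleftrightarrow> x = y) \<and>
     (\<forall>x\<in>X. \<forall>y\<in>X. \<forall>z\<in>X. \<Delta> x z \<le> \<Delta> x y + \<Delta> y z) \<and>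
     (\<forall>x\<in>X. \<forall>y\<in>X. \<Delta> x y = \<Delta> y x)"

definition quasi_order_on :: "'a set \<Rightarrow> ('a \<Rightarrow> 'a \<Rightarrow> bool) \<Rightarrow> bool" where
  "quasi_order_on X le \<longleftrightarrow> reflp_on X le \<and> transp_on X le"

definition vconverges :: "('a \<Rightarrow> 'a \<Rightarrow> real ^ 'q) \<Rightarrow> (nat \<Rightarrow> 'a) \<Rightarrow> 'a \<Rightarrow> bool" where
  "vconverges \<Delta> s x \<longleftrightarrow> (\<lambda>n. \<Delta> (s n) x) \<longlonglongrightarrow> 0"

definition vCauchy :: "('a \<Rightarrow> 'a \<Rightarrow> real ^ 'q) \<Rightarrow> (nat \<Rightarrow> 'a) \<Rightarrow> bool" where
  "vCauchy \<Delta> s \<longleftrightarrow>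
     ((\<lambda>(i, j). \<Delta> (s i) (s j)) \<longlongrightarrow> 0) (sequentially \<times>\<^sub>F sequentially)"

definition ascending_in :: "'a set \<Rightarrow> ('a \<Rightarrow> 'a \<Rightarrow> bool) \<Rightarrow> (nat \<Rightarrow> 'a) \<Rightarrow> bool" where
  "ascending_in X le s \<longleftrightarrow> range s \<subseteq> X \<and> (\<forall>n m. n \<le> m \<longrightarrow> le (s n) (s m))"

definition order_complete_on ::
    "'a set \<Rightarrow> ('a \<Rightarrow> 'a \<Rightarrow> real ^ 'q) \<Rightarrow> ('a \<Rightarrow> 'a \<Rightarrow> bool) \<Rightarrow> bool" where
  "order_complete_on X \<Delta> le \<longleftrightarrow>
     (\<forall>s. ascending_in X le s \<and> vCauchy \<Delta> s \<longrightarrow> (\<exists>x\<in>X. vconverges \<Delta> s x))"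

definition self_closed_on ::
    "'a set \<Rightarrow> ('a \<Rightarrow> 'a \<Rightarrow> real ^ 'q) \<Rightarrow> ('a \<Rightarrow> 'a \<Rightarrow> bool) \<Rightarrow> bool" where
  "self_closed_on X \<Delta> le \<longleftrightarrow>
     (\<forall>s. \<forall>x\<in>X. ascending_in X le s \<and> vconverges \<Delta> s x \<longrightarrow> (\<forall>n. le (s n) x))"

definition order_continuous_on ::
    "'a set \<Rightarrow> ('a \<Rightarrow> 'a \<Rightarrow> real ^ 'q) \<Rightarrow> ('a \<Rightarrow> 'a \<Rightarrow> bool) \<Rightarrow> ('a \<Rightarrow> 'a) \<Rightarrow> bool" where
  "order_continuous_on X \<Delta> le T \<longleftrightarrow>
     (\<forall>s. \<forall>x\<in>X. ascending_in X le s \<and> vconverges \<Delta> s x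
        \<longrightarrow> vconverges \<Delta> (\<lambda>n. T (s n)) (T x))"

definition nonneg_matrix :: "real ^ 'q ^ 'q \<Rightarrow> bool" where
  "nonneg_matrix A \<longleftrightarrow> (\<forall>i j. 0 \<le> A $ i $ j)"

definition matrix_nu :: "real ^ 'q ^ 'q \<Rightarrow> real" where
  "matrix_nu A = Inf {r. 0 \<le> r \<and> (\<exists>z. (\<forall>i. 0 < z $ i) \<and> A *v z \<le> r *\<^sub>R z)}"

definition normal_matrix :: "real ^ 'q ^ 'q \<Rightarrow> bool" where
  "normal_matrix A \<longleftrightarrow> nonneg_matrix A \<and> matrix_nu A < 1"

definition ascent_set :: "'a set \<Rightarrow> ('a \<Rightarrow> 'a \<Rightarrow> bool) \<Rightarrow> ('a \<Rightarrow> 'a) \<Rightarrow> 'a set" where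
  "ascent_set X le T = {x \<in> X. le x (T x)}"

definition Picard_operator ::
    "'a set \<Rightarrow> ('a \<Rightarrow> 'a \<Rightarrow> real ^ 'q) \<Rightarrow> ('a \<Rightarrow> 'a \<Rightarrow> bool) \<Rightarrow> ('a \<Rightarrow> 'a) \<Rightarrow> bool" where
  "Picard_operator X \<Delta> le T \<longleftrightarrow>
     (\<forall>x\<in>ascent_set X le T.
        (\<exists>z\<in>X. vconverges \<Delta> (\<lambda>n. (T ^^ n) x) z) \<and>
        (\<forall>z\<in>X. vconverges \<Delta> (\<lambda>n. (T ^^ n) x) z \<longrightarrow> z = T z))"

end

theory Submission
  imports Defs
begin

text \<open>
  A normal matrix \<open>A\<close> contracts some strictly positive vector: \<open>A *v z \<le> r *\<^sub>R z\<close> with \<open>r < 1\<close>.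
  Choosing \<open>C\<close> with \<open>\<Delta> x (T x) \<le> ((1 - r) * C) *\<^sub>R z\<close>, induction along the orbit of \<open>x\<close> gives
  \<open>\<Delta> x (T\<^sup>k x) \<le> C *\<^sub>R z\<close> and hence \<open>\<Delta> (T\<^sup>n x) (T\<^sup>n\<^sup>+\<^sup>k x) \<le> (r\<^sup>n * C) *\<^sub>R z\<close>, so the orbit is
  Cauchy. Self-closedness together with the contraction gives continuity of \<open>T\<close> along the
  orbit, so in either case the limit is a fixed point.
\<close>

lemma tendsto_zero_squeeze_vec:
  fixes f g :: "'b \<Rightarrow> real ^ 'q"
  assumes "\<And>x. 0 \<le> f x" "\<And>x. f x \<le> g x" "(g \<longlongrightarrow> 0) F"
  shows "(f \<longlongrightarrow> 0) F"
proof (rule Lim_null_comparison)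
  have "norm (f x) \<le> norm (g x)" for x
  proof (rule norm_le_componentwise_cart)
    fix i
    have "0 \<le> f x $ i" "f x $ i \<le> g x $ i"
      using assms(1)[of x] assms(2)[of x] by (auto simp: less_eq_vec_def)
    then show "norm (f x $ i) \<le> norm (g x $ i)" by simp
  qed
  then show "\<forall>\<^sub>F x in F. norm (f x) \<le> norm (g x)" by simp
  show "((\<lambda>x. norm (g x)) \<longlongrightarrow> 0) F"
    using assms(3) by (rule tendsto_norm_zero)
qed

lemma matrix_vector_mult_mono:
  fixes A :: "real ^ 'q ^ 'q"
  assumes "nonneg_matrix A" "u \<le> v"
  shows "A *v u \<le> A *v v"
  using assms unfolding nonneg_matrix_def less_eq_vec_def matrix_vector_mult_def
  by (auto intro!: sum_mono mult_left_mono)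

text \<open>An infimum below 1 yields a member below 1 once the set is known to be nonempty, so most
  of the proof exhibits some admissible factor, however large.\<close>

lemma normal_matrixE:
  fixes A :: "real ^ 'q ^ 'q"
  assumes "normal_matrix A"
  obtains r z where "0 \<le> r" "r < 1" "\<And>i. 0 < z $ i" "A *v z \<le> r *\<^sub>R z"
proof -
  let ?S = "{r. 0 \<le> r \<and> (\<exists>z. (\<forall>i. 0 < z $ i) \<and> A *v z \<le> r *\<^sub>R z)}"
  let ?r = "\<Sum>i\<in>UNIV. \<Sum>j\<in>UNIV. A $ i $ j"
  have nn: "0 \<le> A $ i $ j" for i j
    using assms by (auto simp: normal_matrix_def nonneg_matrix_def)
  \<comment> \<open>Each row sum of \<open>A\<close> is at most the sum of all entries, so this
    total is an admissible factor for the all-ones vector.\<close>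
  have "(\<Sum>j\<in>UNIV. A $ i $ j) \<le> ?r" for i
    by (rule member_le_sum[where f = "\<lambda>i. \<Sum>j\<in>UNIV. A $ i $ j"]) (auto intro!: sum_nonneg nn)
  then have "A *v 1 \<le> ?r *\<^sub>R 1"
    by (simp add: less_eq_vec_def matrix_vector_mult_def)
  moreover have "\<forall>i. 0 < (1 :: real ^ 'q) $ i" by simp
  moreover have "0 \<le> ?r" by (intro sum_nonneg nn)
  ultimately have "?r \<in> ?S" by blast
  moreover have "Inf ?S < 1"
    using assms by (simp add: normal_matrix_def matrix_nu_def)
  ultimately obtain r where "r \<in> ?S" "r < 1"
    using cInf_lessD by (metis (lifting) empty_iff)
  then show ?thesis using that by blast
qed

lemma le_scaleR_positive_vec:
  fixes d z :: "real ^ 'q"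
  assumes "\<And>i. 0 < z $ i" "0 \<le> d"
  obtains c where "0 \<le> c" "d \<le> c *\<^sub>R z"
proof
  \<comment> \<open>The smallest admissible factor is the maximum of these quotients; their sum is a
    convenient upper bound for it.\<close>
  let ?c = "\<Sum>i\<in>UNIV. d $ i / z $ i"
  have nn: "0 \<le> d $ i / z $ i" for i
    using assms(1)[of i] assms(2) by (simp add: less_eq_vec_def)
  show "0 \<le> ?c" by (intro sum_nonneg nn)
  have "d $ i \<le> ?c * z $ i" for i
  proof -
    have "d $ i / z $ i \<le> ?c"
      by (rule member_le_sum[where f = "\<lambda>i. d $ i / z $ i"]) (auto intro: nn)
    then show ?thesis using assms(1)[of i] by (simp add: pos_divide_le_eq)
  qed
  then show "d \<le> ?c *\<^sub>R z" by (simp add: less_eq_vec_def)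
qed

lemma funpow_ascending:
  assumes "quasi_order_on X le" "T \<in> X \<rightarrow> X"
    and mono: "\<forall>x\<in>X. \<forall>y\<in>X. le x y \<longrightarrow> le (T x) (T y)"
    and "x \<in> ascent_set X le T"
  shows "ascending_in X le (\<lambda>n. (T ^^ n) x)"
proof -
  have x: "x \<in> X" "le x (T x)" using assms(4) by (auto simp: ascent_set_def)
  have in_X: "(T ^^ n) x \<in> X" for n
    by (induction n) (use x assms(2) in auto)
  have succ: "le ((T ^^ n) x) ((T ^^ Suc n) x)" for n
  proof (induction n)
    case (Suc n)
    then show ?case using mono in_X[of n] in_X[of "Suc n"] by simp
  qed (use x in simp)
  have "le ((T ^^ n) x) ((T ^^ m) x)" if "n \<le> m" for n m
    using that
  proof (induction m rule: dec_induct)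
    case base
    then show ?case
      using assms(1) in_X by (auto simp: quasi_order_on_def reflp_on_def)
  next
    case (step m)
    have "transp_on X le" using assms(1) by (simp add: quasi_order_on_def)
    from transp_onD[OF this in_X in_X in_X step.IH succ[of m]] show ?case .
  qed
  then show ?thesis using in_X by (auto simp: ascending_in_def)
qed

text \<open>Measuring distances in multiples of the fixed vector \<open>z\<close> turns the matrix
  contraction into a scalar one with factor \<open>r\<close>, so no powers of \<open>A\<close>
  appear. The bound is uniform in \<open>k\<close>, as the Cauchy property requires.\<close>

lemma funpow_vdist_bound:
  fixes A :: "real ^ 'q ^ 'q"
  assumes "vmetric_on X \<Delta>"
    and asc: "ascending_in X le (\<lambda>n. (T ^^ n) x)"
    and contr: "\<forall>x\<in>X. \<forall>y\<in>X. le x y \<longrightarrow> \<Delta> (T x) (T y) \<le> A *v \<Delta> x y"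
    and "nonneg_matrix A" "A *v z \<le> r *\<^sub>R z"
    and "0 \<le> r" "0 \<le> C" "\<Delta> x (T x) \<le> ((1 - r) * C) *\<^sub>R z" "0 \<le> z"
  shows "\<Delta> ((T ^^ n) x) ((T ^^ (n + k)) x) \<le> (r ^ n * C) *\<^sub>R z"
proof -
  have in_X: "(T ^^ n) x \<in> X" for n using asc by (auto simp: ascending_in_def)
  have le: "le ((T ^^ n) x) ((T ^^ m) x)" if "n \<le> m" for n m
    using asc that by (auto simp: ascending_in_def)
  \<comment> \<open>The orbit ascends, so its members are comparable and the contraction applies;
    nonnegativity of \<open>A\<close> then lets the bound \<open>b *\<^sub>R z\<close> pass through
    the multiplication.\<close>
  have contr_step: "\<Delta> ((T ^^ Suc n) x) ((T ^^ Suc m) x) \<le> (r * b) *\<^sub>R z"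
    if "n \<le> m" "0 \<le> b" "\<Delta> ((T ^^ n) x) ((T ^^ m) x) \<le> b *\<^sub>R z" for n m b
  proof -
    have "\<Delta> ((T ^^ Suc n) x) ((T ^^ Suc m) x) \<le> A *v \<Delta> ((T ^^ n) x) ((T ^^ m) x)"
      using contr in_X le[OF that(1)] by simp
    also have "\<dots> \<le> A *v (b *\<^sub>R z)"
      by (rule matrix_vector_mult_mono) fact+
    also have "\<dots> = b *\<^sub>R (A *v z)"
      by (simp add: matrix_vector_mult_scaleR)
    also have "\<dots> \<le> b *\<^sub>R (r *\<^sub>R z)"
      using \<open>A *v z \<le> r *\<^sub>R z\<close> that(2)
      by (auto simp: less_eq_vec_def mult.assoc intro: mult_left_mono)
    finally show ?thesis by (simp add: mult.commute)
  qed
  have x0: "\<Delta> x ((T ^^ k) x) \<le> C *\<^sub>R z" for k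
  proof (induction k)
    case 0
    have "\<Delta> x x = 0" using in_X[of 0] assms(1) by (simp add: vmetric_on_def)
    then show ?case using assms by (simp add: less_eq_vec_def)
  next
    case (Suc k)
    \<comment> \<open>Splitting off the first step leaves the images of \<open>x\<close> and
      \<open>(T ^^ k) x\<close>, to which the induction hypothesis carries over by one contraction.
      The constant reproduces itself: \<open>(1 - r) * C + r * C = C\<close>.\<close>
    have "\<Delta> x ((T ^^ Suc k) x) \<le> \<Delta> x (T x) + \<Delta> (T x) ((T ^^ Suc k) x)"
      using in_X[of 0] in_X[of 1] in_X[of "Suc k"] assms(1) by (simp add: vmetric_on_def)
    also have "\<dots> \<le> ((1 - r) * C) *\<^sub>R z + (r * C) *\<^sub>R z"
      using contr_step[of 0 k C] Suc assms by (intro add_mono) auto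
    also have "\<dots> = C *\<^sub>R z"
      by (simp add: algebra_simps)
    finally show ?case .
  qed
  show ?thesis
  proof (induction n)
    case (Suc n)
    have "\<Delta> ((T ^^ Suc n) x) ((T ^^ Suc (n + k)) x) \<le> (r * (r ^ n * C)) *\<^sub>R z"
      using Suc assms by (intro contr_step) auto
    then show ?case by (simp add: mult.assoc)
  qed (use x0 in simp)
qed

lemma geometric_vCauchy:
  assumes "vmetric_on X \<Delta>" "range s \<subseteq> X" "0 \<le> r" "r < 1" "0 \<le> v"
    and bound: "\<And>n k. \<Delta> (s n) (s (n + k)) \<le> r ^ n *\<^sub>R v"
  shows "vCauchy \<Delta> s"
  unfolding vCauchy_def
proof (rule tendsto_zero_squeeze_vec)
  \<comment> \<open>The hypothesis \<open>bound\<close> covers only \<open>i \<le> j\<close>. This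
    majorant is symmetric, so the other order follows by symmetry of \<open>\<Delta>\<close>, and
    each of its summands depends on one index only.\<close>
  let ?g = "\<lambda>(i, j). (r ^ i + r ^ j) *\<^sub>R v"
  have in_X: "s n \<in> X" for n using assms(2) by auto
  show "0 \<le> (case p of (i, j) \<Rightarrow> \<Delta> (s i) (s j))" for p
    using assms(1) in_X by (auto simp: vmetric_on_def split: prod.split)
  have le: "\<Delta> (s i) (s j) \<le> (r ^ i + r ^ j) *\<^sub>R v" if "i \<le> j" for i j
  proof -
    have "\<Delta> (s i) (s j) \<le> r ^ i *\<^sub>R v" using bound[of i "j - i"] that by simp
    also have "\<dots> \<le> (r ^ i + r ^ j) *\<^sub>R v"
      using assms(3,5) by (auto simp: less_eq_vec_def intro!: mult_right_mono)
    finally show ?thesis .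
  qed
  have "\<Delta> (s i) (s j) \<le> (r ^ i + r ^ j) *\<^sub>R v" for i j
  proof (cases "i \<le> j")
    case False
    have "\<Delta> (s i) (s j) = \<Delta> (s j) (s i)"
      using assms(1) in_X by (auto simp: vmetric_on_def)
    then show ?thesis using le[of j i] False by (simp add: add.commute)
  qed (rule le)
  then show "(case p of (i, j) \<Rightarrow> \<Delta> (s i) (s j)) \<le> ?g p" for p
    by (auto split: prod.split)
  have pow: "(\<lambda>n. r ^ n) \<longlonglongrightarrow> 0"
    using assms(3,4) by (intro LIMSEQ_realpow_zero)
  have "((\<lambda>p. (r ^ fst p + r ^ snd p) *\<^sub>R v) \<longlongrightarrow> (0 + 0) *\<^sub>R v) (sequentially \<times>\<^sub>F sequentially)"
    by (intro tendsto_intros filterlim_compose[OF pow] filterlim_fst filterlim_snd)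
  then show "(?g \<longlongrightarrow> 0) (sequentially \<times>\<^sub>F sequentially)"
    by (simp add: case_prod_unfold)
qed

text \<open>By symmetry and the triangle inequality the constant \<open>\<Delta> x y\<close> lies
  below a sequence tending to 0.\<close>

lemma vconverges_unique:
  assumes "vmetric_on X \<Delta>" "range s \<subseteq> X" "x \<in> X" "y \<in> X"
    and "vconverges \<Delta> s x" "vconverges \<Delta> s y"
  shows "x = y"
proof -
  have in_X: "s n \<in> X" for n using assms(2) by auto
  have "((\<lambda>_ :: nat. \<Delta> x y) \<longlonglongrightarrow> 0)"
  proof (rule tendsto_zero_squeeze_vec)
    show "0 \<le> \<Delta> x y" using assms by (simp add: vmetric_on_def)
    show "\<Delta> x y \<le> \<Delta> (s n) x + \<Delta> (s n) y" for n
    proof -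
      have "\<Delta> x y \<le> \<Delta> x (s n) + \<Delta> (s n) y" "\<Delta> x (s n) = \<Delta> (s n) x"
        using assms(1,3,4) in_X[of n] unfolding vmetric_on_def by blast+
      then show ?thesis by simp
    qed
    show "(\<lambda>n. \<Delta> (s n) x + \<Delta> (s n) y) \<longlonglongrightarrow> 0"
      using assms(5,6) tendsto_add_zero by (auto simp: vconverges_def)
  qed
  then have "\<Delta> x y = 0" by (simp add: LIMSEQ_const_iff)
  then show ?thesis using assms by (simp add: vmetric_on_def)
qed

theorem theorem3:
  fixes X :: "'a set"
    and \<Delta> :: "'a \<Rightarrow> 'a \<Rightarrow> real ^ 'q"
    and le :: "'a \<Rightarrow> 'a \<Rightarrow> bool"  (infix "\<preceq>" 50)
    and T :: "'a \<Rightarrow> 'a"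
  assumes "vmetric_on X \<Delta>"
    and "quasi_order_on X (\<preceq>)"
    and "T \<in> X \<rightarrow> X"
    and "ascent_set X (\<preceq>) T \<noteq> {}"
    and "\<forall>x\<in>X. \<forall>y\<in>X. x \<preceq> y \<longrightarrow> T x \<preceq> T y"
    and "order_complete_on X \<Delta> (\<preceq>)"
    and "\<exists>A :: real ^ 'q ^ 'q. normal_matrix A \<and>
           (\<forall>x\<in>X. \<forall>y\<in>X. x \<preceq> y \<longrightarrow> \<Delta> (T x) (T y) \<le> A *v \<Delta> x y)"
    and "order_continuous_on X \<Delta> (\<preceq>) T \<or> self_closed_on X \<Delta> (\<preceq>)"
  shows "Picard_operator X \<Delta> (\<preceq>) T"
proof -
  obtain A :: "real ^ 'q ^ 'q" where A: "normal_matrix A"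
    and contr: "\<forall>x\<in>X. \<forall>y\<in>X. x \<preceq> y \<longrightarrow> \<Delta> (T x) (T y) \<le> A *v \<Delta> x y"
    using assms(7) by blast
  obtain r z where r: "0 \<le> r" "r < 1" and z: "\<And>i. 0 < z $ i" and Az: "A *v z \<le> r *\<^sub>R z"
    using normal_matrixE[OF A] by blast
  have z0: "0 \<le> z" using z by (simp add: less_eq_vec_def less_imp_le)
  show ?thesis
    unfolding Picard_operator_def
  proof (intro ballI conjI impI)
    fix x assume x: "x \<in> ascent_set X (\<preceq>) T"
    let ?s = "\<lambda>n. (T ^^ n) x"
    have asc: "ascending_in X (\<preceq>) ?s"
      using funpow_ascending[OF assms(2,3,5) x] .
    then have s: "range ?s \<subseteq> X" by (simp add: ascending_in_def)
    have "x \<in> X" "T x \<in> X" using x assms(3) by (auto simp: ascent_set_def)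
    then have "0 \<le> \<Delta> x (T x)" using assms(1) by (simp add: vmetric_on_def)
    then obtain c where c: "0 \<le> c" "\<Delta> x (T x) \<le> c *\<^sub>R z"
      using le_scaleR_positive_vec[OF z] by blast
    \<comment> \<open>The sum of the geometric series with first term \<open>c\<close> and ratio
      \<open>r\<close>.\<close>
    define C where "C = c / (1 - r)"
    have C: "0 \<le> C" "c = (1 - r) * C" using c r by (auto simp: C_def)
    have bound: "\<Delta> (?s n) (?s (n + k)) \<le> r ^ n *\<^sub>R (C *\<^sub>R z)" for n k
      using funpow_vdist_bound[OF assms(1) asc contr _ Az r(1) C(1) _ z0] A c(2) C(2)
      by (simp add: normal_matrix_def)
    have "0 \<le> C *\<^sub>R z" using C(1) z0 by (simp add: less_eq_vec_def)
    then have "vCauchy \<Delta> ?s"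
      using geometric_vCauchy[OF assms(1) s r _ bound] by blast
    then show "\<exists>w\<in>X. vconverges \<Delta> ?s w"
      using asc assms(6) by (auto simp: order_complete_on_def)
  next
    \<comment> \<open>Here \<open>w\<close> is an arbitrary limit of the orbit in \<open>X\<close>,
      not only the one obtained from completeness.\<close>
    fix x w
    let ?s = "\<lambda>n. (T ^^ n) x"
    assume x: "x \<in> ascent_set X (\<preceq>) T" and w: "w \<in> X" and conv: "vconverges \<Delta> ?s w"
    have asc: "ascending_in X (\<preceq>) ?s"
      using funpow_ascending[OF assms(2,3,5) x] .
    then have s: "?s n \<in> X" for n by (auto simp: ascending_in_def)
    have Tw: "T w \<in> X" using w assms(3) by auto
    have "vconverges \<Delta> (\<lambda>n. T (?s n)) (T w)"
      using assms(8)
    proof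
      assume "order_continuous_on X \<Delta> (\<preceq>) T"
      then show ?thesis using asc w conv unfolding order_continuous_on_def by blast
    next
      assume "self_closed_on X \<Delta> (\<preceq>)"
      \<comment> \<open>The contraction is available only for comparable points; self-closedness
        makes every iterate comparable with \<open>w\<close>.\<close>
      then have le: "?s n \<preceq> w" for n
        using asc w conv unfolding self_closed_on_def by blast
      show ?thesis
        unfolding vconverges_def
      proof (rule tendsto_zero_squeeze_vec)
        show "0 \<le> \<Delta> (T (?s n)) (T w)" for n
          using assms(1) s[of "Suc n"] Tw by (simp add: vmetric_on_def)
        show "\<Delta> (T (?s n)) (T w) \<le> A *v \<Delta> (?s n) w" for n
          using contr s w le by blast
        have "(\<lambda>n. A *v \<Delta> (?s n) w) \<longlonglongrightarrow> A *v 0"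
          using conv unfolding vconverges_def
          by (rule bounded_linear.tendsto[OF matrix_vector_mul_bounded_linear])
        then show "(\<lambda>n. A *v \<Delta> (?s n) w) \<longlonglongrightarrow> 0" by simp
      qed
    qed
    \<comment> \<open>Since \<open>T (?s n)\<close> is \<open>?s (Suc n)\<close>, the shifted orbit
      tends both to \<open>T w\<close> and to \<open>w\<close>, and uniqueness of limits identifies
      them.\<close>
    then have "vconverges \<Delta> (\<lambda>n. ?s (Suc n)) (T w)" by simp
    moreover have "vconverges \<Delta> (\<lambda>n. ?s (Suc n)) w"
      using conv unfolding vconverges_def by (rule LIMSEQ_Suc)
    moreover have "range (\<lambda>n. ?s (Suc n)) \<subseteq> X" using s by blast
    ultimately show "w = T w"
      using vconverges_unique[OF assms(1) _ w Tw] by blast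
  qed
qed

end
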